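(* Let $z$ be an indeterminate. For every $n\ge1$, in $\mathbb{Q}(z)$, $$\sum_{F\in PF(n)}\prod_{h\in\mathcal{H}(F)}\frac{(2h-z)^{h-1}}{h(2h-2+z)^{h-2}}=\frac{z}{n!}(2n+z)^{n-1}.$$
   Context: A plane tree is a rooted unlabeled tree in which the (nonempty) subtrees of each vertex are arranged in linear order; a plane forest is a linearly ordered sequence of plane trees; $PF(n)$ is the set of plane forests with $n$ vertices. For a vertex $u$ of a forest $F$, the hook length $h_u$ is the number of descendants of $u$ (counting $u$ itself), and $\mathcal{H}(F)$ is the multiset of hook lengths of all vertices; the product is over all vertices. For $h=1$ the exponent $h-2=-1$ is a genuine negative power. *)

theory Defs
  imports
    "HOL-Library.Multiset"
    "HOL-Library.Sublist"
    "HOL-Computational_Algebra.Polynomial"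
    "HOL-Computational_Algebra.Fraction_Field"
begin

datatype plane_tree = Node (children: "plane_tree list")

type_synonym plane_forest = "plane_tree list"

text \<open>
  A vertex is addressed by the path leading to it: the index of its tree in the forest,
  followed by the indices of the successive children (all counted from 0). The empty path
  is not a vertex. The descendants of a vertex are then the vertices whose address extends
  its own.
\<close>

fun is_vertex :: "plane_forest \<Rightarrow> nat list \<Rightarrow> bool" where
  "is_vertex F [] \<longleftrightarrow> False"
| "is_vertex F (i # p) \<longleftrightarrow> i < length F \<and> (p = [] \<or> is_vertex (children (F ! i)) p)"

definition vertices :: "plane_forest \<Rightarrow> nat list set" where
  "vertices F = {u. is_vertex F u}"

definition descendants :: "plane_forest \<Rightarrow> nat list \<Rightarrow> nat list set" where
  "descendants F u = {v \<in> vertices F. prefix u v}"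

definition hook_length :: "plane_forest \<Rightarrow> nat list \<Rightarrow> nat" where
  "hook_length F u = card (descendants F u)"

definition hook_lengths :: "plane_forest \<Rightarrow> nat multiset" where
  "hook_lengths F = image_mset (hook_length F) (mset_set (vertices F))"

definition PF :: "nat \<Rightarrow> plane_forest set" where
  "PF n = {F. card (vertices F) = n}"

definition indet :: "rat poly fract" where
  "indet = Fract [:0, 1:] 1"

text \<open>
  Finiteness of the index sets: the cardinalities, multisets and sums over them are not
  affected by the default values that the library assigns to infinite sets.
\<close>

lemma vertices_Nil [simp]: "vertices [] = {}"
proof -
  have "\<not> is_vertex [] u" for u by (cases u) auto
  then show ?thesis by (simp add: vertices_def)
qed

lemma vertices_Cons:
  "vertices (Node G # F) =
     insert [0] ((#) 0 ` vertices G \<union> (\<lambda>u. Suc (hd u) # tl u) ` vertices F)"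
proof (rule set_eqI)
  fix u
  show "u \<in> vertices (Node G # F) \<longleftrightarrow>
     u \<in> insert [0] ((#) 0 ` vertices G \<union> (\<lambda>u. Suc (hd u) # tl u) ` vertices F)"
  proof (cases u)
    case Nil
    then show ?thesis by (auto simp: vertices_def)
  next
    case (Cons i p)
    show ?thesis
    proof (cases i)
      case 0
      then show ?thesis using Cons by (auto simp: vertices_def)
    next
      case (Suc j)
      have "u \<in> (\<lambda>u. Suc (hd u) # tl u) ` vertices F \<longleftrightarrow> j # p \<in> vertices F"
      proof
        assume "u \<in> (\<lambda>u. Suc (hd u) # tl u) ` vertices F"
        then obtain v where v: "v \<in> vertices F" "u = Suc (hd v) # tl v" by blast
        then have "v \<noteq> []" by (auto simp: vertices_def)
        with v Cons Suc show "j # p \<in> vertices F" by (cases v) auto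
      next
        assume "j # p \<in> vertices F"
        then show "u \<in> (\<lambda>u. Suc (hd u) # tl u) ` vertices F"
          using Cons Suc by (intro image_eqI[of _ _ "j # p"]) auto
      qed
      then show ?thesis using Cons Suc by (auto simp: vertices_def)
    qed
  qed
qed

lemma finite_vertices [simp]: "finite (vertices F)"
proof (induction "size_list size F" arbitrary: F rule: less_induct)
  case less
  show ?case
  proof (cases F)
    case (Cons t F')
    obtain G where t: "t = Node G" by (cases t)
    have "finite (vertices G)" "finite (vertices F')"
      using less Cons t by auto
    then show ?thesis using Cons t by (simp add: vertices_Cons)
  qed simp
qed

lemma card_vertices_Cons:
  "card (vertices (Node G # F)) = Suc (card (vertices G) + card (vertices F))"
proof -
  let ?s = "\<lambda>u::nat list. Suc (hd u) # tl u"
  have ne: "u \<noteq> []" if "u \<in> vertices H" for u H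
    using that by (auto simp: vertices_def)
  have inj: "inj_on ?s (vertices F)"
    by (rule inj_onI) (metis ne list.inject list.collapse Suc_inject)
  have "[0] \<notin> (#) 0 ` vertices G \<union> ?s ` vertices F"
    using ne by auto
  then have "card (vertices (Node G # F)) = Suc (card ((#) 0 ` vertices G \<union> ?s ` vertices F))"
    by (simp add: vertices_Cons)
  also have "card ((#) 0 ` vertices G \<union> ?s ` vertices F)
      = card ((#) 0 ` vertices G) + card (?s ` vertices F)"
    by (rule card_Un_disjoint) auto
  finally show ?thesis by (simp add: card_image inj)
qed

lemma finite_PF: "finite (PF n)"
proof (induction n rule: less_induct)
  case (less n)
  let ?S = "\<Union>k<n. PF k"
  have "PF n \<subseteq> insert [] ((\<lambda>(G, F). Node G # F) ` (?S \<times> ?S))"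
  proof
    fix F assume F: "F \<in> PF n"
    show "F \<in> insert [] ((\<lambda>(G, F). Node G # F) ` (?S \<times> ?S))"
    proof (cases F)
      case (Cons t F')
      obtain G where t: "t = Node G" by (cases t)
      have "G \<in> ?S" "F' \<in> ?S"
        using F Cons t by (auto simp: PF_def card_vertices_Cons)
      then show ?thesis using Cons t by auto
    qed simp
  qed
  moreover have "finite ?S" using less by auto
  ultimately show ?case by (meson finite_SigmaI finite_imageI finite_insert finite_subset)
qed

end

theory Submission
  imports Defs
begin

text \<open>
  Removing the root of the first tree of a forest turns the weighted sum \<open>W n\<close> over \<open>PF n\<close>
  into the recurrence \<open>W (n + 1) = (\<Sum>k\<le>n. w (k + 1) * W k * W (n - k))\<close>. With the Abel
  polynomials \<open>A\<^sub>k(x) = x (x + 2 k)^(k - 1)\<close>, the claim is \<open>W n = A\<^sub>n(z) / n!\<close>, and the weight is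
  designed so that \<open>w (k + 1) * A\<^sub>k(z) / k! = - A\<^sub>k\<^sub>+\<^sub>1(-z) / (k + 1)!\<close>. The recurrence therefore
  amounts to Abel's convolution \<open>(\<Sum>k\<le>n. (n choose k) A\<^sub>k(x) A\<^sub>n\<^sub>-\<^sub>k(y)) = A\<^sub>n(x + y)\<close> at
  \<open>x = -z\<close>, \<open>y = z\<close>, where the right-hand side vanishes.
\<close>

section \<open>Abel's binomial identities\<close>

text \<open>Up to sign this is an \<open>m\<close>-th finite difference with step \<open>a\<close>,
  which kills powers of degree \<open>d < m\<close>. The induction on \<open>d\<close> splits one
  factor \<open>x + of_nat k * a\<close> off the power.\<close>

lemma alternating_sum_choose_power_eq_0:
  fixes x a :: "'a::comm_ring_1"
  assumes "d < m"
  shows "(\<Sum>k\<le>m. (-1) ^ k * of_nat (m choose k) * (x + of_nat k * a) ^ d) = 0"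
  using assms
proof (induction d arbitrary: m x)
  case 0
  then show ?case using choose_alternating_sum[of m, where 'a = 'a] by simp
next
  case (Suc d)
  then obtain l where m: "m = Suc l" and l: "d < l" by (cases m) auto
  have "(\<Sum>k\<le>m. (-1) ^ k * of_nat (m choose k) * (x + of_nat k * a) ^ Suc d)
      = x * (\<Sum>k\<le>m. (-1) ^ k * of_nat (m choose k) * (x + of_nat k * a) ^ d)
        + a * (\<Sum>k\<le>m. (-1) ^ k * of_nat (k * (m choose k)) * (x + of_nat k * a) ^ d)"
    by (simp add: sum_distrib_left sum.distrib[symmetric] algebra_simps)
  \<comment> \<open>The factor \<open>k\<close> kills the term \<open>k = 0\<close>; absorbing it
    into the binomial lowers \<open>m\<close> by one and shifts \<open>x\<close> to
    \<open>x + a\<close>.\<close>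
  also have "(\<Sum>k\<le>m. (-1) ^ k * of_nat (k * (m choose k)) * (x + of_nat k * a) ^ d)
      = - of_nat m * (\<Sum>k\<le>l. (-1) ^ k * of_nat (l choose k) * ((x + a) + of_nat k * a) ^ d)"
    unfolding m sum.atMost_Suc_shift
    by (simp only: Suc_times_binomial)
       (simp add: sum_distrib_left sum_negf[symmetric] algebra_simps)
  finally show ?case using Suc.IH[of m x] Suc.IH[of l "x + a"] Suc.prems l by simp
qed

text \<open>The value at \<open>k = 0\<close> interprets \<open>x * x powi (-1)\<close> as 1, also for \<open>x = 0\<close>.\<close>

definition abel_poly :: "'a::comm_ring_1 \<Rightarrow> nat \<Rightarrow> 'a \<Rightarrow> 'a" where
  "abel_poly a k x = (if k = 0 then 1 else x * (x + of_nat k * a) ^ (k - 1))"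

lemma abel_poly_0 [simp]: "abel_poly a 0 x = 1"
  by (simp add: abel_poly_def)

text \<open>Makes the exponent independent of \<open>k\<close>, as the alternating sum
  requires.\<close>

lemma abel_poly_mult_power:
  assumes "k \<le> m" "0 < m"
  shows "abel_poly a k x * (x + of_nat k * a) ^ (m - k) = x * (x + of_nat k * a) ^ (m - 1)"
  using assms
  by (auto simp: abel_poly_def mult.assoc power_add[symmetric] power_Suc[symmetric]
           simp del: power_Suc)

text \<open>Expand \<open>y - k a = (x + y) - (x + k a)\<close> in powers of \<open>x + y\<close>.
  Every coefficient except that of \<open>(x + y) ^ n\<close> contains an alternating sum that
  vanishes.\<close>

lemma abel_binomial:
  fixes x y a :: "'a::comm_ring_1"
  shows "(\<Sum>k\<le>n. of_nat (n choose k) * abel_poly a k x * (y - of_nat k * a) ^ (n - k))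
       = (x + y) ^ n"
proof -
  \<comment> \<open>The left-hand side at \<open>y = - x\<close>, with \<open>m\<close> in place of
    \<open>n\<close>.\<close>
  define g where "g m = (\<Sum>k\<le>m. of_nat (m choose k) * abel_poly a k x *
    (- (x + of_nat k * a)) ^ (m - k))" for m
  have g0: "g m = 0" if "0 < m" for m
  proof -
    have "g m = (\<Sum>k\<le>m. (-1) ^ m * x *
        ((-1) ^ k * of_nat (m choose k) * (x + of_nat k * a) ^ (m - 1)))"
      unfolding g_def
    proof (rule sum.cong[OF refl])
      fix k assume "k \<in> {..m}"
      then have k: "k \<le> m" by simp
      have s: "(-1) ^ (m - k) = ((-1) ^ m * (-1) ^ k :: 'a)"
        using k by (auto simp: minus_one_power_iff)
      have "of_nat (m choose k) * abel_poly a k x * (- (x + of_nat k * a)) ^ (m - k)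
          = (-1) ^ (m - k) * of_nat (m choose k) *
            (abel_poly a k x * (x + of_nat k * a) ^ (m - k))"
        by (subst power_minus) (simp add: ac_simps)
      then show "of_nat (m choose k) * abel_poly a k x * (- (x + of_nat k * a)) ^ (m - k)
          = (-1) ^ m * x * ((-1) ^ k * of_nat (m choose k) * (x + of_nat k * a) ^ (m - 1))"
        unfolding abel_poly_mult_power[OF k that] s by (simp add: ac_simps)
    qed
    then show ?thesis
      using alternating_sum_choose_power_eq_0[of "m - 1" m x a] that
      by (simp add: sum_distrib_left[symmetric])
  qed
  let ?h = "\<lambda>k j. of_nat (n choose k) * abel_poly a k x *
    (of_nat (n - k choose j) * (x + y) ^ j * (- (x + of_nat k * a)) ^ (n - k - j))"
  have "(\<Sum>k\<le>n. of_nat (n choose k) * abel_poly a k x * (y - of_nat k * a) ^ (n - k))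
      = (\<Sum>k\<le>n. \<Sum>j\<le>n - k. ?h k j)"
  proof (rule sum.cong[OF refl])
    fix k
    have "(y - of_nat k * a) ^ (n - k) = ((x + y) + - (x + of_nat k * a)) ^ (n - k)"
      by simp
    then show "of_nat (n choose k) * abel_poly a k x * (y - of_nat k * a) ^ (n - k)
        = (\<Sum>j\<le>n - k. ?h k j)"
      by (simp only: binomial_ring sum_distrib_left)
  qed
  also have "\<dots> = (\<Sum>j\<le>n. \<Sum>k\<le>n - j. ?h k j)"
    unfolding sum.Sigma[OF finite_atMost ballI[OF finite_atMost]]
    by (rule sum.reindex_bij_witness[of _ prod.swap prod.swap]) auto
  also have "\<dots> = (\<Sum>j\<le>n. of_nat (n choose j) * (x + y) ^ j * g (n - j))"
  proof (rule sum.cong[OF refl])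
    fix j assume "j \<in> {..n}"
    have "?h k j = of_nat (n choose j) * (x + y) ^ j *
        (of_nat (n - j choose k) * abel_poly a k x * (- (x + of_nat k * a)) ^ (n - j - k))"
      if "k \<le> n - j" for k
    proof -
      \<comment> \<open>Both sides equal
        \<open>(n choose (j + k)) * ((j + k) choose k)\<close>.\<close>
      have "(n choose k) * (n - k choose j) = (n choose j) * (n - j choose k)"
        using that \<open>j \<in> {..n}\<close> choose_mult[of k "j + k" n] choose_mult[of j "j + k" n]
          binomial_symmetric[of k "j + k"] by simp
      then have c: "(of_nat (n choose k) * of_nat (n - k choose j) :: 'a)
          = of_nat (n choose j) * of_nat (n - j choose k)"
        by (metis of_nat_mult)
      have "?h k j = (of_nat (n choose k) * of_nat (n - k choose j)) *
          ((x + y) ^ j * abel_poly a k x * (- (x + of_nat k * a)) ^ (n - j - k))"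
        by (simp add: ac_simps)
      then show ?thesis unfolding c by (simp add: ac_simps)
    qed
    then show "(\<Sum>k\<le>n - j. ?h k j) = of_nat (n choose j) * (x + y) ^ j * g (n - j)"
      unfolding g_def sum_distrib_left by (intro sum.cong) auto
  qed
  also have "\<dots> = (\<Sum>j\<in>{n}. of_nat (n choose j) * (x + y) ^ j * g (n - j))"
    by (rule sum.mono_neutral_right) (auto simp: g0)
  finally show ?thesis by (simp add: g_def)
qed

text \<open>Writing \<open>y = (Y - k a) - (n - k) a\<close> turns
  \<open>abel_poly a (n - k) y\<close> into a difference of two powers. Each resulting sum is an
  instance of \<open>abel_binomial\<close>, and the two combine because
  \<open>x + Y - n a = x + y\<close>.\<close>

lemma abel_convolution:
  fixes x y a :: "'a::comm_ring_1"
  shows "(\<Sum>k\<le>n. of_nat (n choose k) * abel_poly a k x * abel_poly a (n - k) y)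
       = abel_poly a n (x + y)"
proof (cases n)
  case (Suc m)
  define Y where "Y = y + of_nat n * a"
  have split: "abel_poly a (n - k) y
      = (Y - of_nat k * a) ^ (n - k) - of_nat (n - k) * a * (Y - of_nat k * a) ^ (n - k - 1)"
    if "k \<le> n" for k
  proof (cases "n - k")
    case (Suc l)
    have "Y - of_nat k * a = y + of_nat (n - k) * a"
      using that by (simp add: Y_def of_nat_diff algebra_simps)
    then show ?thesis by (simp add: abel_poly_def Suc algebra_simps)
  qed simp
  have absorb: "(of_nat (n choose k) * of_nat (n - k) :: 'a) = of_nat n * of_nat (m choose k)"
    if "k \<le> n" for k
    using binomial_absorb_comp[of n k] Suc by (metis diff_Suc_1 mult.commute of_nat_mult)
  have "(\<Sum>k\<le>n. of_nat (n choose k) * abel_poly a k x * abel_poly a (n - k) y)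
      = (\<Sum>k\<le>n. of_nat (n choose k) * abel_poly a k x * (Y - of_nat k * a) ^ (n - k)
          - (of_nat (n choose k) * of_nat (n - k)) * a * abel_poly a k x *
            (Y - of_nat k * a) ^ (n - k - 1))"
    by (rule sum.cong) (simp_all add: split algebra_simps)
  also have "\<dots> = (x + Y) ^ n - (\<Sum>k\<le>n. (of_nat (n choose k) * of_nat (n - k)) * a *
      abel_poly a k x * (Y - of_nat k * a) ^ (n - k - 1))"
    by (simp only: sum_subtractf abel_binomial)
  also have "(\<Sum>k\<le>n. (of_nat (n choose k) * of_nat (n - k)) * a *
        abel_poly a k x * (Y - of_nat k * a) ^ (n - k - 1))
      = (\<Sum>k\<le>n. of_nat n * a *
          (of_nat (m choose k) * abel_poly a k x * (Y - of_nat k * a) ^ (m - k)))"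
    by (rule sum.cong) (simp_all only: atMost_iff absorb, simp add: Suc ac_simps)
  \<comment> \<open>The term \<open>k = n\<close> drops out since
    \<open>m choose n = 0\<close>.\<close>
  also have "\<dots> = of_nat n * a * (\<Sum>k\<le>m. of_nat (m choose k) * abel_poly a k x *
      (Y - of_nat k * a) ^ (m - k))"
    by (simp only: sum_distrib_left[symmetric] Suc sum.atMost_Suc) (simp add: binomial_eq_0)
  also have "\<dots> = of_nat n * a * (x + Y) ^ m"
    by (simp only: abel_binomial)
  finally show ?thesis
    by (simp add: Suc abel_poly_def Y_def algebra_simps)
qed simp

section \<open>Hook lengths of a nonempty forest\<close>

lemma Nil_notin_vertices [simp]: "[] \<notin> vertices F"
  by (simp add: vertices_def)

lemma inj_on_shift: "inj_on (\<lambda>u. Suc (hd u) # tl u) (vertices F)"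
proof (rule inj_onI)
  fix u v assume "u \<in> vertices F" "v \<in> vertices F" "Suc (hd u) # tl u = Suc (hd v) # tl v"
  then show "u = v" by (cases u; cases v) auto
qed

lemma hook_length_root: "hook_length (Node G # F) [0] = Suc (card (vertices G))"
proof -
  have "descendants (Node G # F) [0] = insert [0] ((#) 0 ` vertices G)"
    by (auto simp: descendants_def vertices_Cons)
  moreover have "[0] \<notin> (#) 0 ` vertices G" by auto
  ultimately show ?thesis by (simp add: hook_length_def card_image)
qed

lemma hook_length_child:
  assumes "u \<in> vertices G"
  shows "hook_length (Node G # F) (0 # u) = hook_length G u"
proof -
  \<comment> \<open>For empty \<open>u\<close> the root \<open>[0]\<close> itself would be a
    descendant outside the image.\<close>
  have "u \<noteq> []" using assms by auto
  then have "descendants (Node G # F) (0 # u) = (#) 0 ` descendants G u"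
    by (auto simp: descendants_def vertices_Cons)
  then show ?thesis by (simp add: hook_length_def card_image)
qed

lemma hook_length_shift:
  assumes "u \<in> vertices F"
  shows "hook_length (Node G # F) (Suc (hd u) # tl u) = hook_length F u"
proof -
  let ?s = "\<lambda>u::nat list. Suc (hd u) # tl u"
  have "prefix (?s u) (?s v) \<longleftrightarrow> prefix u v" if "v \<in> vertices F" for v
    using assms that by (cases u; cases v) auto
  then have "descendants (Node G # F) (?s u) = ?s ` descendants F u"
    by (auto simp: descendants_def vertices_Cons)
  moreover have "inj_on ?s (descendants F u)"
    by (rule inj_on_subset[OF inj_on_shift]) (auto simp: descendants_def)
  ultimately show ?thesis by (simp add: hook_length_def card_image)
qed

text \<open>Removing the first root only relabels the other vertices; their sets of descendants
  correspond bijectively.\<close>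

lemma hook_lengths_Cons:
  "hook_lengths (Node G # F)
     = add_mset (Suc (card (vertices G))) (hook_lengths G + hook_lengths F)"
proof -
  let ?s = "\<lambda>u::nat list. Suc (hd u) # tl u"
  have "[0] \<notin> (#) 0 ` vertices G \<union> ?s ` vertices F" by auto
  then have "mset_set (vertices (Node G # F))
      = add_mset [0] (mset_set ((#) 0 ` vertices G \<union> ?s ` vertices F))"
    by (simp add: vertices_Cons)
  also have "mset_set ((#) 0 ` vertices G \<union> ?s ` vertices F)
      = mset_set ((#) 0 ` vertices G) + mset_set (?s ` vertices F)"
    by (rule mset_set_Union) auto
  also have "mset_set ((#) 0 ` vertices G) = image_mset ((#) 0) (mset_set (vertices G))"
    by (simp add: image_mset_mset_set)
  also have "mset_set (?s ` vertices F) = image_mset ?s (mset_set (vertices F))"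
    by (simp add: image_mset_mset_set inj_on_shift)
  finally have "hook_lengths (Node G # F)
      = add_mset (Suc (card (vertices G)))
          (image_mset (\<lambda>u. hook_length (Node G # F) (0 # u)) (mset_set (vertices G))
         + image_mset (\<lambda>u. hook_length (Node G # F) (?s u)) (mset_set (vertices F)))"
    by (simp add: hook_lengths_def hook_length_root multiset.map_comp comp_def)
  moreover have "image_mset (\<lambda>u. hook_length (Node G # F) (0 # u)) (mset_set (vertices G))
      = hook_lengths G"
    unfolding hook_lengths_def by (rule image_mset_cong) (simp add: hook_length_child)
  moreover have "image_mset (\<lambda>u. hook_length (Node G # F) (?s u)) (mset_set (vertices F))
      = hook_lengths F"
    unfolding hook_lengths_def by (rule image_mset_cong) (simp add: hook_length_shift)
  ultimately show ?thesis by simp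
qed

section \<open>Recurrence for weighted sums over forests\<close>

lemma PF_0: "PF 0 = {[]}"
proof -
  have "F = []" if "card (vertices F) = 0" for F
    using that by (cases F; cases "hd F") (auto simp: vertices_Cons)
  then show ?thesis by (auto simp: PF_def)
qed

lemma PF_Suc: "PF (Suc n) = (\<lambda>(k, G, F). Node G # F) ` (SIGMA k:{..n}. PF k \<times> PF (n - k))"
proof (rule set_eqI)
  fix H
  show "H \<in> PF (Suc n) \<longleftrightarrow>
    H \<in> (\<lambda>(k, G, F). Node G # F) ` (SIGMA k:{..n}. PF k \<times> PF (n - k))"
  proof
    assume H: "H \<in> PF (Suc n)"
    then obtain G F where "H = Node G # F"
      by (cases H; cases "hd H") (auto simp: PF_def)
    with H show "H \<in> (\<lambda>(k, G, F). Node G # F) ` (SIGMA k:{..n}. PF k \<times> PF (n - k))"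
      by (intro image_eqI[of _ _ "(card (vertices G), G, F)"])
         (auto simp: PF_def card_vertices_Cons)
  qed (auto simp: PF_def card_vertices_Cons)
qed

definition hook_sum :: "(nat \<Rightarrow> 'a::comm_semiring_1) \<Rightarrow> nat \<Rightarrow> 'a" where
  "hook_sum w n = (\<Sum>F\<in>PF n. \<Prod>h\<in>#hook_lengths F. w h)"

lemma hook_sum_0: "hook_sum w 0 = 1"
  by (simp add: hook_sum_def PF_0 hook_lengths_def)

lemma hook_sum_Suc: "hook_sum w (Suc n) = (\<Sum>k\<le>n. w (Suc k) * hook_sum w k * hook_sum w (n - k))"
proof -
  let ?S = "SIGMA k:{..n}. PF k \<times> PF (n - k)"
  let ?P = "\<lambda>F. \<Prod>h\<in>#hook_lengths F. w h"
  \<comment> \<open>The index \<open>k\<close> is recovered as the number of vertices of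
    \<open>G\<close>.\<close>
  have "inj_on (\<lambda>(k, G, F). Node G # F) ?S"
    by (auto simp: inj_on_def PF_def)
  then have "hook_sum w (Suc n) = (\<Sum>(k, G, F)\<in>?S. ?P (Node G # F))"
    by (simp add: hook_sum_def PF_Suc sum.reindex comp_def case_prod_unfold)
  also have "\<dots> = (\<Sum>(k, G, F)\<in>?S. w (Suc k) * (?P G * ?P F))"
    by (rule sum.cong) (auto simp: hook_lengths_Cons PF_def)
  also have "\<dots> = (\<Sum>k\<le>n. \<Sum>(G, F)\<in>PF k \<times> PF (n - k). w (Suc k) * (?P G * ?P F))"
    by (subst sum.Sigma) (auto simp: finite_PF)
  also have "\<dots> = (\<Sum>k\<le>n. w (Suc k) * (hook_sum w k * hook_sum w (n - k)))"
    unfolding hook_sum_def sum_product sum.cartesian_product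
    by (simp add: sum_distrib_left case_prod_unfold)
  finally show ?thesis by (simp only: mult.assoc)
qed

section \<open>Evaluation of the sum\<close>

text \<open>\<open>char0\<close> allows division by factorials, and \<open>nz\<close> allows the
  powers in the denominators of the weights to be cancelled.\<close>

lemma hook_sum_eq_abel_poly:
  fixes z :: "'a::field"
  assumes char0: "\<And>k. 0 < k \<Longrightarrow> (of_nat k :: 'a) \<noteq> 0"
    and nz: "\<And>k. 2 * of_nat k + z \<noteq> 0"
  defines "w \<equiv> \<lambda>h. (2 * of_nat h - z) ^ (h - 1) /
            (of_nat h * (2 * of_nat h - 2 + z) powi (int h - 2))"
  shows "hook_sum w n = abel_poly 2 n z / of_nat (fact n)"
proof (induction n rule: less_induct)
  case (less n)
  have f: "(of_nat (fact k) :: 'a) \<noteq> 0" for k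
    by (rule char0) simp
  have weight: "w (Suc k) * (abel_poly 2 k z / of_nat (fact k))
      = - abel_poly 2 (Suc k) (- z) / of_nat (fact (Suc k))" for k
  proof (cases k)
    \<comment> \<open>The exponent is -1 here, so that \<open>w 1 = z\<close>.\<close>
    case 0
    then show ?thesis by (simp add: w_def abel_poly_def divide_inverse)
  next
    case (Suc j)
    have d: "2 * of_nat (Suc k) - 2 + z = z + of_nat k * 2"
      by (simp add: algebra_simps)
    have c: "2 * of_nat (Suc k) - z = - z + of_nat (Suc k) * 2"
      by (simp add: algebra_simps)
    \<comment> \<open>For positive \<open>k\<close> the integer exponent is nonnegative, and the
      denominator cancels the power in \<open>abel_poly 2 k z\<close>.\<close>
    have e: "int (Suc k) - 2 = int (k - 1)" using Suc by simp
    have "w (Suc k) = (- z + of_nat (Suc k) * 2) ^ k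
        / (of_nat (Suc k) * (z + of_nat k * 2) ^ (k - 1))"
      unfolding w_def d c e power_int_of_nat by simp
    moreover have "abel_poly 2 k z = z * (z + of_nat k * 2) ^ (k - 1)"
      using Suc by (simp add: abel_poly_def)
    moreover have "abel_poly 2 (Suc k) (- z) = - z * (- z + of_nat (Suc k) * 2) ^ k"
      by (simp add: abel_poly_def)
    moreover have "z + of_nat k * 2 \<noteq> 0"
      using nz[of k] by (simp add: ac_simps)
    moreover have "(of_nat (fact (Suc k)) :: 'a) = of_nat (Suc k) * of_nat (fact k)"
      by (simp only: fact_Suc of_nat_mult of_nat_id)
    ultimately show ?thesis
      by (simp del: of_nat_Suc fact_Suc)
  qed
  show ?case
  proof (cases n)
    case 0
    then show ?thesis by (simp add: hook_sum_0)
  next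
    case (Suc m)
    have binom: "(of_nat (n choose Suc k) :: 'a)
        = of_nat (fact n) / (of_nat (fact (Suc k)) * of_nat (fact (m - k)))" if "k \<le> m" for k
    proof -
      have "fact (Suc k) * fact (m - k) * (n choose Suc k) = (fact n :: nat)"
        using binomial_fact_lemma[of "Suc k" n] that Suc by simp
      then have "(of_nat (fact (Suc k)) * of_nat (fact (m - k)) * of_nat (n choose Suc k) :: 'a)
          = of_nat (fact n)"
        by (metis of_nat_mult)
      then show ?thesis
        using f[of "Suc k"] f[of "m - k"] by (simp add: field_simps del: fact_Suc)
    qed
    \<comment> \<open>Both \<open>k\<close> and \<open>m - k\<close> are below \<open>n\<close>, so
      the induction hypothesis applies to both factors.\<close>
    have "hook_sum w n = (\<Sum>k\<le>m. w (Suc k) * (abel_poly 2 k z / of_nat (fact k)) *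
        (abel_poly 2 (m - k) z / of_nat (fact (m - k))))"
      unfolding Suc hook_sum_Suc by (rule sum.cong) (simp_all add: less Suc)
    also have "\<dots> = (\<Sum>k\<le>m. - (of_nat (n choose Suc k) * abel_poly 2 (Suc k) (- z) *
        abel_poly 2 (n - Suc k) z) / of_nat (fact n))"
    proof (rule sum.cong[OF refl])
      fix k assume "k \<in> {..m}"
      moreover have "n - Suc k = m - k" using Suc by simp
      ultimately show "w (Suc k) * (abel_poly 2 k z / of_nat (fact k)) *
            (abel_poly 2 (m - k) z / of_nat (fact (m - k)))
          = - (of_nat (n choose Suc k) * abel_poly 2 (Suc k) (- z) *
            abel_poly 2 (n - Suc k) z) / of_nat (fact n)"
        unfolding weight using f[of n] by (simp add: binom del: fact_Suc)
    qed
    also have "\<dots> = - (\<Sum>k\<le>m. of_nat (n choose Suc k) * abel_poly 2 (Suc k) (- z) *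
        abel_poly 2 (n - Suc k) z) / of_nat (fact n)"
      by (simp only: sum_negf[symmetric] sum_divide_distrib)
    also have "(\<Sum>k\<le>m. of_nat (n choose Suc k) * abel_poly 2 (Suc k) (- z) *
        abel_poly 2 (n - Suc k) z) = - abel_poly 2 n z"
    proof -
      \<comment> \<open>The recurrence supplies all terms of the convolution at \<open>- z\<close>
        and \<open>z\<close> but the initial one, which is \<open>abel_poly 2 n z\<close>.\<close>
      have "abel_poly 2 n z + (\<Sum>k\<le>m. of_nat (n choose Suc k) * abel_poly 2 (Suc k) (- z) *
          abel_poly 2 (n - Suc k) z) = abel_poly 2 n (- z + z)"
        unfolding abel_convolution[symmetric] Suc sum.atMost_Suc_shift by simp
      also have "\<dots> = 0" by (simp add: abel_poly_def Suc)
      finally show ?thesis by (simp add: add_eq_0_iff)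
    qed
    finally show ?thesis by simp
  qed
qed

section \<open>Specialization to the field of rational functions\<close>

lemma of_nat_fract: "of_nat k = Fract (of_nat k) 1"
  by (induction k) (simp_all add: Zero_fract_def One_fract_def)

theorem theorem3p9:
  fixes n :: nat
  assumes "n \<ge> 1"
  shows "(\<Sum>F\<in>PF n. \<Prod>h\<in>#hook_lengths F.
            (2 * of_nat h - indet) ^ (h - 1) /
            (of_nat h * (2 * of_nat h - 2 + indet) powi (int h - 2)))
         = indet / of_nat (fact n) * (2 * of_nat n + indet) ^ (n - 1)"
proof -
  have "(of_nat k :: rat poly fract) \<noteq> 0" if "0 < k" for k
    using that by (simp add: of_nat_fract Zero_fract_def eq_fract)
  moreover have "2 * of_nat k + indet \<noteq> 0" for k
  proof -
    \<comment> \<open>As a polynomial this has leading coefficient 1, hence it is nonzero.\<close>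
    have "2 * of_nat k + indet = of_nat (2 * k) + Fract [:0, 1:] 1"
      by (simp add: indet_def)
    also have "\<dots> = Fract [:of_nat (2 * k), 1:] 1"
      unfolding of_nat_fract by (simp add: of_nat_poly del: of_nat_mult)
    also have "\<dots> \<noteq> 0" by (simp add: Zero_fract_def eq_fract)
    finally show ?thesis .
  qed
  \<comment> \<open>Since \<open>n\<close> is positive, \<open>abel_poly\<close> unfolds to its
    product branch.\<close>
  ultimately show ?thesis
    using hook_sum_eq_abel_poly[of indet n] assms
    by (simp add: hook_sum_def abel_poly_def ac_simps)
qed

end
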